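(* Let $M \ge 2$, $N\ge 1$, $p \ge 0$ be integers with $\operatorname{rad}(M) \nmid \operatorname{rad}(N)$, let $\xi$ be a primitive $M$-th root of unity, and let $(\beta_k^{(p)})_{k\ge0}$ be defined by $\sum_{k\ge 0}\beta_k^{(p)} z^k = G_p(z)/(1-z)^{p+1}$ with $G_p(z)=\sum_{m=0}^{M^{p+1}-1}\xi^{\mathcal{B}_{M,N}(m)}z^m$. Then for every function $f:\mathbb{C}\to\mathbb{C}$ and all $x,y\in\mathbb{C}$, $$\sum_{n=0}^{M^{p+1}-1} \xi^{\mathcal{B}_{M,N}(n)} f(x+ny) = (-1)^{p+1} \sum_{k \ge 0} \beta_k^{(p)} \, \Delta_y^{p+1} f(x+ky),$$ where $\Delta_y^{p+1} g(u) := \sum_{j=0}^{p+1} (-1)^{p+1-j} \binom{p+1}{j} g(u+jy)$.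
   Context: For integers $M\ge 2$, $N \ge 1$ and $n\ge 0$ with base-$M$ expansion $n=\sum_{i\ge 0} d_i(n) M^i$, $d_i(n)\in\{0,\dots,M-1\}$, the base-shifting map is $\mathcal{B}_{M,N}(n) := \sum_{i\ge 0} d_i(n) N^i$. $\operatorname{rad}(k)$ is the product of the distinct prime factors of $k$. Under the hypothesis, $G_p(z)$ is divisible by $(1-z)^{p+1}$, so $(\beta_k^{(p)})$ has finite support and the right-hand sum is finite. *)

theory Defs
  imports Complex_Main
    "HOL-Computational_Algebra.Primes"
    "HOL-Computational_Algebra.Formal_Power_Series"
begin

definition rad :: "nat \<Rightarrow> nat" where
  "rad k = \<Prod>(prime_factors k)"

definition base_digit :: "nat \<Rightarrow> nat \<Rightarrow> nat \<Rightarrow> nat" where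
  "base_digit M n i = n div M ^ i mod M"

text \<open>The index set is the support of the digit sequence, which is finite for \<open>M \<ge> 2\<close>.\<close>
definition base_shift :: "nat \<Rightarrow> nat \<Rightarrow> nat \<Rightarrow> nat" where
  "base_shift M N n = (\<Sum>i | base_digit M n i \<noteq> 0. base_digit M n i * N ^ i)"

definition primitive_root_of_unity :: "nat \<Rightarrow> complex \<Rightarrow> bool" where
  "primitive_root_of_unity M \<xi> \<longleftrightarrow> \<xi> ^ M = 1 \<and> (\<forall>k. 0 < k \<and> k < M \<longrightarrow> \<xi> ^ k \<noteq> 1)"

definition G_fps :: "nat \<Rightarrow> nat \<Rightarrow> complex \<Rightarrow> nat \<Rightarrow> complex fps" where
  "G_fps M N \<xi> p = (\<Sum>m<M ^ (p + 1). fps_const (\<xi> ^ base_shift M N m) * fps_X ^ m)"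

text \<open>The denominator has constant term 1, so the quotient is the exact one in the ring of formal
  power series.\<close>
definition beta :: "nat \<Rightarrow> nat \<Rightarrow> complex \<Rightarrow> nat \<Rightarrow> nat \<Rightarrow> complex" where
  "beta M N \<xi> p k = fps_nth (G_fps M N \<xi> p / (1 - fps_X) ^ (p + 1)) k"

definition forward_diff :: "nat \<Rightarrow> complex \<Rightarrow> (complex \<Rightarrow> complex) \<Rightarrow> complex \<Rightarrow> complex" where
  "forward_diff r y g u =
     (\<Sum>j\<le>r. (-1) ^ (r - j) * of_nat (r choose j) * g (u + of_nat j * y))"

end

theory Submission
  imports Defs "HOL-Computational_Algebra.Polynomial_FPS"
begin

text \<open>
  Splitting the digit expansion, $G_p(z) = \prod_{i \le p} \sum_{d<M} (\xi^{N^i} z^{M^i})^d$.  Some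
  prime divides $M$ but not $N$, so $\xi^{N^i} \ne 1$ and every factor is a geometric sum that
  vanishes at $z = 1$; hence $G_p = (1-z)^{p+1} H$ with a polynomial $H$, whose coefficients are the
  \<open>\<beta>\<^sub>k\<close>. Applying the linear functional $z^n \mapsto f(x+ny)$ to this identity turns multiplication
  by $(1-z)^{p+1}$ into $(-1)^{p+1} \Delta_y^{p+1}$.
\<close>

text \<open>The linear functional on polynomials that sends the monomial \<open>z^i\<close> to
  \<open>g i\<close>. Keeping \<open>g\<close> arbitrary lets multiplication of the polynomial be
  traded for shifts of \<open>g\<close>.\<close>

definition coeff_pairing :: "(nat \<Rightarrow> 'a) \<Rightarrow> 'a::comm_ring_1 poly \<Rightarrow> 'a" where
  "coeff_pairing g P = (\<Sum>i\<le>degree P. coeff P i * g i)"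

text \<open>Terms outside the support vanish, so any finite superset of the support may serve as
  index set. This avoids computing exact degrees, which may drop in sums and products.\<close>

lemma coeff_pairing_eq_sum:
  assumes "finite A" and "\<And>i. coeff P i \<noteq> 0 \<Longrightarrow> i \<in> A"
  shows "coeff_pairing g P = (\<Sum>i\<in>A. coeff P i * g i)"
proof -
  have fin: "finite {i. coeff P i \<noteq> 0}"
    using assms by (auto intro: finite_subset)
  have "coeff_pairing g P = (\<Sum>i | coeff P i \<noteq> 0. coeff P i * g i)"
    unfolding coeff_pairing_def by (rule sum.mono_neutral_right) (auto intro: le_degree)
  also have "\<dots> = (\<Sum>i\<in>A. coeff P i * g i)"
    using assms by (intro sum.mono_neutral_left) auto
  finally show ?thesis .
qed

lemma coeff_pairing_add: "coeff_pairing g (P + Q) = coeff_pairing g P + coeff_pairing g Q"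
proof -
  let ?A = "{..max (degree P) (degree Q)}"
  have "coeff_pairing g R = (\<Sum>i\<in>?A. coeff R i * g i)" if "degree R \<le> max (degree P) (degree Q)" for R
    by (rule coeff_pairing_eq_sum) (use that in \<open>auto dest!: le_degree\<close>)
  then show ?thesis
    by (simp add: degree_add_le_max distrib_right sum.distrib)
qed

lemma coeff_pairing_smult: "coeff_pairing g (smult a P) = a * coeff_pairing g P"
  using coeff_pairing_eq_sum[of "{..degree P}" "smult a P" g]
  by (force simp: coeff_pairing_def sum_distrib_left mult.assoc intro: le_degree)

lemma coeff_pairing_pCons: "coeff_pairing g (pCons a P) = a * g 0 + coeff_pairing (\<lambda>i. g (Suc i)) P"
proof -
  have "coeff_pairing g (pCons a P) = (\<Sum>i\<le>Suc (degree P). coeff (pCons a P) i * g i)"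
    by (rule coeff_pairing_eq_sum) (auto dest: le_degree simp: coeff_pCons split: nat.splits)
  then show ?thesis
    by (simp only: sum.atMost_Suc_shift coeff_pCons_0 coeff_pCons_Suc coeff_pairing_def)
qed

text \<open>By linearity this is the fact that \<open>z^i * z^j\<close> pairs to
  \<open>g (i + j)\<close>. The induction needs \<open>g\<close> arbitrary because
  \<open>pCons\<close> replaces it by its shift.\<close>

lemma coeff_pairing_mult:
  "coeff_pairing g (P * Q) = coeff_pairing (\<lambda>i. coeff_pairing (\<lambda>j. g (i + j)) Q) P"
proof (induction P arbitrary: g)
  case 0
  then show ?case by (simp add: coeff_pairing_def)
next
  case (pCons a P)
  then show ?case
    by (simp add: coeff_pairing_add coeff_pairing_smult coeff_pairing_pCons)
qed

text \<open>Binomial theorem: the coefficient of \<open>z^j\<close> in \<open>(1-z)^r\<close>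
  carries the sign \<open>(-1)^j\<close>, the forward difference carries \<open>(-1)^(r-j)\<close>,
  and the two differ by the factor \<open>(-1)^r\<close>.\<close>

lemma coeff_pairing_one_minus_power:
  fixes y :: complex
  shows "coeff_pairing (\<lambda>j. f (u + of_nat j * y)) ([:1, -1:] ^ r) = (-1) ^ r * forward_diff r y f u"
proof -
  have "coeff_pairing (\<lambda>j. f (u + of_nat j * y)) ([:1, -1:] ^ r) =
      (\<Sum>j\<le>r. coeff ([:1, -1:] ^ r) j * f (u + of_nat j * y))"
    using degree_power_le[of "[:1, -1 :: complex:]" r]
    by (intro coeff_pairing_eq_sum) (auto dest!: le_degree)
  also have "\<dots> = (\<Sum>j\<le>r. (-1) ^ r * ((-1) ^ (r - j) * of_nat (r choose j) * f (u + of_nat j * y)))"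
  proof (rule sum.cong[OF refl])
    fix j assume j: "j \<in> {..r}"
    then have "(-1 :: complex) ^ j = (-1) ^ r * (-1) ^ (r - j)"
      by (simp add: minus_one_power_iff)
    then show "coeff ([:1, -1:] ^ r) j * f (u + of_nat j * y) =
        (-1) ^ r * ((-1) ^ (r - j) * of_nat (r choose j) * f (u + of_nat j * y))"
      using j by (simp add: coeff_linear_poly_power mult_ac)
  qed
  finally show ?thesis by (simp add: forward_diff_def sum_distrib_left)
qed

lemma base_shift_eq_sum:
  assumes "n < M ^ r"
  shows "base_shift M N n = (\<Sum>i<r. base_digit M n i * N ^ i)"
  unfolding base_shift_def
proof (rule sum.mono_neutral_left)
  show "{i. base_digit M n i \<noteq> 0} \<subseteq> {..<r}"
  proof clarsimp
    fix i assume *: "0 < base_digit M n i"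
    show "i < r"
    proof (rule ccontr)
      assume "\<not> i < r"
      \<comment> \<open>For \<open>M = 0\<close> the bound \<open>n < 0 ^ r\<close> forces
        \<open>n = 0\<close>, whose digits all vanish, against the assumption on \<open>i\<close>.
        Positivity makes the powers of \<open>M\<close> monotone.\<close>
      moreover have "0 < M"
        using * assms by (cases "M = 0") (auto simp: base_digit_def power_0_left split: if_splits)
      ultimately have "n < M ^ i"
        using assms power_increasing[of r i M] by linarith
      with * show False by (simp add: base_digit_def)
    qed
  qed
qed auto

lemma base_digit_add_mult_power:
  assumes "M > 0" and "i < r"
  shows "base_digit M (q * M ^ r + n) i = base_digit M n i"
proof -
  \<comment> \<open>Since \<open>i < r\<close>, a factor \<open>M * M ^ i\<close> splits off: after
    division by \<open>M ^ i\<close> the added term is still a multiple of \<open>M\<close> and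
    disappears modulo \<open>M\<close>.\<close>
  have "M ^ r = M ^ (r - Suc i) * M * M ^ i"
    using assms by (simp only: flip: power_Suc2 power_add) simp
  then have "q * M ^ r + n = n + q * M ^ (r - Suc i) * M * M ^ i"
    by (simp add: mult.assoc)
  then show ?thesis
    using assms unfolding base_digit_def by (simp only: div_mult_self1 mod_mult_self1) simp
qed

lemma base_shift_add_mult_power:
  assumes "n < M ^ r" and "q < M"
  shows "base_shift M N (q * M ^ r + n) = q * N ^ r + base_shift M N n"
proof -
  have "Suc q * M ^ r \<le> M * M ^ r"
    using assms by (intro mult_right_mono) auto
  then have "q * M ^ r + n < M ^ Suc r"
    using assms by simp
  moreover have "base_digit M (q * M ^ r + n) r = q"
    using assms by (simp add: base_digit_def)
  ultimately show ?thesis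
    using assms by (simp add: base_shift_eq_sum[of "q * M ^ r + n" _ "Suc r"] base_shift_eq_sum[of n _ r]
      base_digit_add_mult_power del: power_Suc)
qed

lemma sum_monom_base_shift:
  fixes \<xi> :: "'a::comm_ring_1"
  shows "(\<Sum>m<M ^ r. monom (\<xi> ^ base_shift M N m) m) =
    (\<Prod>i<r. \<Sum>d<M. monom (\<xi> ^ (d * N ^ i)) (d * M ^ i))"
proof (induction r)
  case 0
  then show ?case by (simp add: base_shift_eq_sum[of 0 M 0])
next
  case (Suc r)
  let ?F = "\<lambda>m. monom (\<xi> ^ base_shift M N m) m"
  \<comment> \<open>Block \<open>d\<close> collects the exponents whose digit at position
    \<open>r\<close> is \<open>d\<close>. On it \<open>base_shift\<close> is additive, so the
    monomials factor.\<close>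
  have "(\<Sum>m<M ^ Suc r. ?F m) = (\<Sum>d<M. \<Sum>m\<in>{d * M ^ r..<d * M ^ r + M ^ r}. ?F m)"
    by (simp add: sum.nat_group)
  also have "\<dots> = (\<Sum>d<M. \<Sum>m<M ^ r. ?F (d * M ^ r + m))"
    by (simp add: sum.atLeastLessThan_shift_0[of _ "_ * _"] atLeast0LessThan)
  also have "\<dots> = (\<Sum>d<M. \<Sum>m<M ^ r. monom (\<xi> ^ (d * N ^ r)) (d * M ^ r) * ?F m)"
    by (intro sum.cong refl) (simp add: base_shift_add_mult_power mult_monom power_add)
  also have "\<dots> = (\<Sum>d<M. monom (\<xi> ^ (d * N ^ r)) (d * M ^ r)) * (\<Sum>m<M ^ r. ?F m)"
    by (simp only: sum_product)
  finally show ?case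
    by (simp add: Suc.IH mult.commute)
qed

text \<open>A prime dividing \<open>M\<close> divides \<open>N ^ i\<close>, hence \<open>N\<close>.
  Used contrapositively, it excludes \<open>M dvd N ^ i\<close> and thereby gives
  \<open>\<xi> ^ (N ^ i) \<noteq> 1\<close>.\<close>

lemma rad_dvd_rad:
  assumes "N > 0" and "M dvd N ^ i"
  shows "rad M dvd rad N"
proof -
  have "prime_factors M \<subseteq> prime_factors N"
    using assms by (auto simp: prime_factors_dvd intro: prime_dvd_power dvd_trans)
  then show ?thesis
    unfolding rad_def by (intro prod_dvd_prod_subset) auto
qed

text \<open>Reducing the exponent modulo \<open>M\<close> leaves a remainder below \<open>M\<close>
  whose power is 1; primitivity forces that remainder to be 0.\<close>

lemma primitive_root_of_unity_power_eq_1: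
  assumes "primitive_root_of_unity M \<xi>" and "M > 0" and "\<xi> ^ k = 1"
  shows "M dvd k"
proof -
  have "\<xi> ^ k = (\<xi> ^ M) ^ (k div M) * \<xi> ^ (k mod M)"
    by (simp flip: power_mult power_add)
  then have "\<xi> ^ (k mod M) = 1"
    using assms by (simp add: primitive_root_of_unity_def)
  then show ?thesis
    using assms by (auto simp: primitive_root_of_unity_def dvd_eq_mod_eq_0
      dest!: spec[of _ "k mod M"])
qed

lemma one_minus_X_power_dvd:
  assumes "M > 0" and "N > 0" and "\<not> rad M dvd rad N" and "primitive_root_of_unity M \<xi>"
  shows "[:1, -1:] ^ r dvd (\<Sum>m<M ^ r. monom (\<xi> ^ base_shift M N m) m)"
proof -
  have "[:1, -1:] dvd (\<Sum>d<M. monom (\<xi> ^ (d * N ^ i)) (d * M ^ i))" for i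
  proof -
    let ?w = "\<xi> ^ (N ^ i)"
    have "?w \<noteq> 1"
      using assms primitive_root_of_unity_power_eq_1 rad_dvd_rad by blast
    moreover have "?w ^ M = 1"
      using assms by (simp add: primitive_root_of_unity_def power_mult[symmetric] mult.commute[of _ M])
        (simp add: power_mult)
    ultimately have "(\<Sum>d<M. ?w ^ d) = 0"
      by (simp add: sum_gp_strict)
    then have "poly (\<Sum>d<M. monom (\<xi> ^ (d * N ^ i)) (d * M ^ i)) 1 = 0"
      by (simp add: poly_sum poly_monom power_mult[symmetric] mult.commute)
    \<comment> \<open>The root criterion yields the divisor \<open>z - 1\<close>, which is the
      negative of \<open>1 - z\<close>.\<close>
    then have "- [:1, -1:] dvd (\<Sum>d<M. monom (\<xi> ^ (d * N ^ i)) (d * M ^ i))"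
      by (simp add: poly_eq_0_iff_dvd)
    then show ?thesis by (simp only: minus_dvd_iff)
  qed
  then have "(\<Prod>i<r. [:1, -1:]) dvd (\<Prod>i<r. \<Sum>d<M. monom (\<xi> ^ (d * N ^ i)) (d * M ^ i))"
    by (intro prod_dvd_prod) auto
  then show ?thesis by (simp add: sum_monom_base_shift)
qed

theorem theorem4p1:
  fixes M N p :: nat and \<xi> :: complex
  assumes "M \<ge> 2" and "N \<ge> 1"
    and "\<not> rad M dvd rad N"
    and "primitive_root_of_unity M \<xi>"
  shows "finite {k. beta M N \<xi> p k \<noteq> 0} \<and>
    (\<forall>(f :: complex \<Rightarrow> complex) x y.
      (\<Sum>n<M ^ (p + 1). \<xi> ^ base_shift M N n * f (x + of_nat n * y)) =
      (-1) ^ (p + 1) *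
        (\<Sum>k | beta M N \<xi> p k \<noteq> 0. beta M N \<xi> p k * forward_diff (p + 1) y f (x + of_nat k * y)))"
proof -
  define G where "G = (\<Sum>m<M ^ (p + 1). monom (\<xi> ^ base_shift M N m) m)"
  obtain H where H: "G = [:1, -1:] ^ (p + 1) * H"
    using one_minus_X_power_dvd[of M N \<xi> "p + 1"] assms unfolding G_def by (auto elim: dvdE)
  have "G_fps M N \<xi> p = fps_of_poly G"
    by (simp add: G_fps_def G_def fps_of_poly_sum fps_of_poly_monom)
  also have "\<dots> = (1 - fps_X) ^ (p + 1) * fps_of_poly H"
    by (simp add: H fps_of_poly_mult fps_of_poly_power fps_of_poly_pCons del: power_Suc)
  \<comment> \<open>Its constant coefficient is 1. Being nonzero, the denominator cancels in the
    quotient that defines \<open>beta\<close>.\<close>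
  moreover have "(1 - fps_X :: complex fps) ^ (p + 1) \<noteq> 0"
    by (metis fps_nth_power_0 fps_sub_nth fps_one_nth fps_X_nth fps_zero_nth power_one diff_zero
      zero_neq_one)
  ultimately have beta: "beta M N \<xi> p k = coeff H k" for k
    unfolding beta_def by (simp del: power_Suc)
  have fin: "finite {k. coeff H k \<noteq> 0}"
    by (rule finite_subset[of _ "{..degree H}"]) (auto intro: le_degree)
  show ?thesis
  proof (intro conjI allI)
    show "finite {k. beta M N \<xi> p k \<noteq> 0}"
      using fin by (simp add: beta)
  next
    fix f :: "complex \<Rightarrow> complex" and x y
    let ?g = "\<lambda>n. f (x + of_nat n * y)"
    have coeff_G: "coeff G n = (if n < M ^ (p + 1) then \<xi> ^ base_shift M N n else 0)" for n
      by (simp add: G_def coeff_sum)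
    have "(\<Sum>n<M ^ (p + 1). \<xi> ^ base_shift M N n * ?g n) = coeff_pairing ?g G"
      by (subst coeff_pairing_eq_sum[of "{..<M ^ (p + 1)}"]) (auto simp: coeff_G split: if_splits)
    also have "\<dots> = coeff_pairing (\<lambda>k. coeff_pairing
        (\<lambda>j. f ((x + of_nat k * y) + of_nat j * y)) ([:1, -1:] ^ (p + 1))) H"
      \<comment> \<open>Commuting the factors makes \<open>H\<close> supply the outer index
        \<open>k\<close>, so that the power of \<open>1 - z\<close> is paired from the base point
        \<open>x + k*y\<close>.\<close>
      unfolding H by (subst mult.commute) (simp only: coeff_pairing_mult of_nat_add distrib_right add.assoc)
    also have "\<dots> = (-1) ^ (p + 1) * (\<Sum>k | coeff H k \<noteq> 0.
        coeff H k * forward_diff (p + 1) y f (x + of_nat k * y))"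
      unfolding coeff_pairing_one_minus_power
      by (subst coeff_pairing_eq_sum[OF fin]) (simp_all add: sum_distrib_left mult.left_commute)
    finally show "(\<Sum>n<M ^ (p + 1). \<xi> ^ base_shift M N n * ?g n) = (-1) ^ (p + 1) *
        (\<Sum>k | beta M N \<xi> p k \<noteq> 0. beta M N \<xi> p k * forward_diff (p + 1) y f (x + of_nat k * y))"
      by (simp add: beta)
  qed
qed

end
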